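(* Let $\mathcal{A}$ be a $C^*$-algebra with unit $e$, let $\Phi\colon\mathcal{A}\to\mathcal{A}$ be a unital linear map, and let $a\in\mathcal{A}$ be such that the restriction $\Phi|_{C^*(e,a)}\colon C^*(e,a)\to\mathcal{A}$ is completely positive. The following assertions are equivalent: (i) $a,a^*a,aa^*\in\mathcal{A}^\Phi$, that is, $\Phi(a)=a$, $\Phi(a^*a)=a^*a$, and $\Phi(aa^* )=aa^*$. (ii) $a\in\mathcal{A}^\Phi\cap\mathcal{M}_\Phi$, that is, $\Phi(a)=a$, $\Phi(a^*a)=\Phi(a)^*\Phi(a)$, and $\Phi(aa^* )=\Phi(a)\Phi(a)^*$. (iii) $\Phi|_{C^*(e,a)}$ has the Bimodule Property, that is, $\Phi(ba)=\Phi(b)a$ and $\Phi(ab)=a\Phi(b)$ for all $b\in C^*(e,a)$. (iv) $C^*(e,a)\subseteq\mathcal{A}^\Phi$, that is, $\Phi(b)=b$ for all $b\in C^*(e,a)$.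
   Context: $C^*(e,a)$ denotes the $C^*$-subalgebra of $\mathcal{A}$ generated by $e$ and $a$. $\mathcal{A}^\Phi=\{x\in\mathcal{A}\mid\Phi(x)=x\}$ is the set of fixed points of $\Phi$, and $\mathcal{M}_\Phi=\{x\in\mathcal{A}\mid\Phi(x^*x)=\Phi(x)^*\Phi(x)\text{ and }\Phi(xx^* )=\Phi(x)\Phi(x^* )\}$ is the multiplicative domain of $\Phi$. *)

theory Defs
  imports "HOL-Analysis.Analysis" "Jordan_Normal_Form.Matrix"
begin

text \<open>The class is an extension of the library's real Banach algebras: \<open>scaleC\<close> extends
  the existing \<open>scaleR\<close> and satisfies the axioms of a complex normed algebra.\<close>

class cstar_algebra = real_normed_algebra + banach +
  fixes scaleC :: "complex \<Rightarrow> 'a \<Rightarrow> 'a" (infixr "*\<^sub>C" 75)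
    and star :: "'a \<Rightarrow> 'a"
  assumes scaleC_add_right: "c *\<^sub>C (x + y) = c *\<^sub>C x + c *\<^sub>C y"
    and scaleC_add_left: "(c + d) *\<^sub>C x = c *\<^sub>C x + d *\<^sub>C x"
    and scaleC_scaleC: "c *\<^sub>C (d *\<^sub>C x) = (c * d) *\<^sub>C x"
    and scaleC_of_real: "complex_of_real r *\<^sub>C x = r *\<^sub>R x"
    and mult_scaleC_left: "(c *\<^sub>C x) * y = c *\<^sub>C (x * y)"
    and mult_scaleC_right: "x * (c *\<^sub>C y) = c *\<^sub>C (x * y)"
    and norm_scaleC: "norm (c *\<^sub>C x) = cmod c * norm x"
    and star_star: "star (star x) = x"
    and star_add: "star (x + y) = star x + star y"
    and star_scaleC: "star (c *\<^sub>C x) = cnj c *\<^sub>C star x"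
    and star_mult: "star (x * y) = star y * star x"
    and cstar_identity: "norm (star x * x) = (norm x)\<^sup>2"

text \<open>Adding \<open>monoid_mult\<close> rather than \<open>real_normed_algebra_1\<close> keeps the zero algebra, where
  \<open>1 = 0\<close>; in any other algebra \<open>norm 1 = 1\<close> follows from the C*-identity.\<close>

class unital_cstar_algebra = cstar_algebra + monoid_mult

definition complex_linear :: "('a::cstar_algebra \<Rightarrow> 'b::cstar_algebra) \<Rightarrow> bool" where
  "complex_linear f \<longleftrightarrow>
     (\<forall>x y. f (x + y) = f x + f y) \<and> (\<forall>c x. f (c *\<^sub>C x) = c *\<^sub>C f x)"

definition cstar_subalgebra :: "'a::cstar_algebra set \<Rightarrow> bool" where
  "cstar_subalgebra B \<longleftrightarrow>
     0 \<in> B \<and> (\<forall>x\<in>B. \<forall>y\<in>B. x + y \<in> B) \<and> (\<forall>c. \<forall>x\<in>B. c *\<^sub>C x \<in> B) \<and>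
     (\<forall>x\<in>B. \<forall>y\<in>B. x * y \<in> B) \<and> (\<forall>x\<in>B. star x \<in> B) \<and> closed B"

definition cstar_generated :: "'a::cstar_algebra set \<Rightarrow> 'a set" where
  "cstar_generated X = cstar_subalgebra hull X"

definition adjoint_mat :: "'a::cstar_algebra mat \<Rightarrow> 'a mat" where
  "adjoint_mat Y = map_mat star (transpose_mat Y)"

text \<open>The positive elements of the C*-algebra \<open>M\<^sub>n(B)\<close>, for a C*-subalgebra \<open>B\<close>, are those
  of the form \<open>Y\<^sup>* Y\<close> with \<open>Y\<close> in \<open>M\<^sub>n(B)\<close>; this makes no reference to the norm of \<open>M\<^sub>n(B)\<close>.\<close>

definition positive_mats :: "nat \<Rightarrow> 'a::cstar_algebra set \<Rightarrow> 'a mat set" where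
  "positive_mats n B =
     {adjoint_mat Y * Y | Y. Y \<in> carrier_mat n n \<and> elements_mat Y \<subseteq> B}"

definition completely_positive_on ::
    "'a::cstar_algebra set \<Rightarrow> ('a \<Rightarrow> 'b::cstar_algebra) \<Rightarrow> bool" where
  "completely_positive_on B \<Phi> \<longleftrightarrow>
     (\<forall>n. \<forall>X \<in> positive_mats n B. map_mat \<Phi> X \<in> positive_mats n UNIV)"

definition fixed_points :: "('a \<Rightarrow> 'a) \<Rightarrow> 'a set" where
  "fixed_points \<Phi> = {x. \<Phi> x = x}"

definition multiplicative_domain :: "('a::cstar_algebra \<Rightarrow> 'a) \<Rightarrow> 'a set" where
  "multiplicative_domain \<Phi> =
     {x. \<Phi> (star x * x) = star (\<Phi> x) * \<Phi> x \<and> \<Phi> (x * star x) = \<Phi> x * \<Phi> (star x)}"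

end

theory Submission
  imports Defs
begin

text \<open>Write \<open>B\<close> for the C*-algebra generated by \<open>1\<close> and \<open>a\<close>. As a positive map, \<open>\<Phi>\<close> commutes with
  the involution on \<open>B\<close>, so (i) and (ii) say the same; (iv) gives (iii) because \<open>B\<close> is closed under
  products, and (iii) gives (i) by taking \<open>b = 1\<close> and \<open>b = star a\<close>. The content is that (i) implies
  (iv), which is Choi's theorem on multiplicative domains.

  Its core is \<open>map_star_mult_left\<close>. The rank-one matrix with entries \<open>star (x\<^sub>i) * x\<^sub>j\<close>, where
  \<open>(x\<^sub>0, x\<^sub>1, x\<^sub>2) = (1, x, b)\<close>, is positive; by complete positivity its image is a matrix
  \<open>Z\<^sup>* Z\<close>, so that \<open>\<Phi> (star (x\<^sub>i) * x\<^sub>j)\<close> is the inner product of columns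
  \<open>i\<close> and \<open>j\<close> of \<open>Z\<close>. Subtract from column \<open>1\<close> its component \<open>Z\<^sub>0 * \<Phi> x\<close> along column \<open>0\<close>. The
  difference has inner square \<open>\<Phi> (star x * x) - star (\<Phi> x) * \<Phi> x\<close>. If this is zero, then the
  difference is zero, and its inner product with column \<open>2\<close>, which is
  \<open>\<Phi> (star x * b) - star (\<Phi> x) * \<Phi> b\<close>, vanishes too. Neither Stinespring's theorem nor a
  representation on a Hilbert space enters.

  The elements of \<open>B\<close> that \<open>\<Phi>\<close> treats as scalars on both sides form a C*-subalgebra
  (\<open>cstar_subalgebra_bimodule_domain\<close>; it is closed because \<open>\<Phi>\<close> is bounded, \<open>norm_map\<close>). Under (i)
  it contains \<open>a\<close> and hence all of \<open>B\<close>, and its elements are fixed, as one sees by multiplying them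
  with \<open>1\<close>.

  What remains is order theory of C*-algebras: that \<open>star x * x\<close> is positive and that a sum of
  such elements vanishes only if each does (\<open>sum_star_mult_eq_0\<close>). It is developed without
  spectra: a positive element is the square of a self-adjoint one, square roots come from an
  iteration, and a self-adjoint \<open>h\<close> is positive iff \<open>norm (t - h) \<le> t\<close> for some \<open>t\<close>, which makes
  the positive elements a cone by the triangle inequality.\<close>

section \<open>The involution\<close>

lemma scaleC_minus_right: "c *\<^sub>C (- x) = - (c *\<^sub>C (x::'a::cstar_algebra))"
  by (metis add.right_inverse add_cancel_right_right neg_eq_iff_add_eq_0 scaleC_add_right)

lemma scaleC_diff_right: "c *\<^sub>C (x - y) = c *\<^sub>C x - c *\<^sub>C (y::'a::cstar_algebra)"
  using scaleC_add_right[of c x "- y"] by (simp add: scaleC_minus_right)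

lemma scaleC_one: "1 *\<^sub>C x = (x::'a::cstar_algebra)"
  using scaleC_of_real[of 1 x] by simp

lemma scaleC_minus_one: "(-1) *\<^sub>C x = - (x::'a::cstar_algebra)"
  using scaleC_of_real[of "-1" x] by simp

lemma star_zero: "star 0 = (0::'a::cstar_algebra)"
  by (metis add_cancel_right_right star_add)

lemma star_minus: "star (- x) = - star (x::'a::cstar_algebra)"
  by (metis add.right_inverse neg_eq_iff_add_eq_0 star_add star_zero)

lemma star_diff: "star (x - y) = star x - star (y::'a::cstar_algebra)"
  using star_add[of x "- y"] by (simp add: star_minus)

lemma star_scaleR: "star (r *\<^sub>R x) = r *\<^sub>R star (x::'a::cstar_algebra)"
  using star_scaleC[of "complex_of_real r" x] by (simp add: scaleC_of_real)

lemma star_one: "star 1 = (1::'a::unital_cstar_algebra)"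
  by (metis mult_1_left mult_1_right star_mult star_star)

lemma norm_le_norm_star: "norm x \<le> norm (star (x::'a::cstar_algebra))"
proof (cases "x = 0")
  case False
  have "norm x * norm x = norm (star x * x)"
    by (simp add: cstar_identity power2_eq_square)
  also have "\<dots> \<le> norm (star x) * norm x"
    by (rule norm_mult_ineq)
  finally show ?thesis
    using False by simp
qed simp

lemma norm_star: "norm (star x) = norm (x::'a::cstar_algebra)"
  using norm_le_norm_star[of x] norm_le_norm_star[of "star x"] by (simp add: star_star)

lemma star_mult_eq_0_iff: "star x * x = 0 \<longleftrightarrow> x = (0::'a::cstar_algebra)"
  by (metis cstar_identity mult_zero_right norm_eq_zero power_eq_0_iff zero_neq_numeral)

lemma norm_self_adjoint_square:
  assumes "star k = (k::'a::cstar_algebra)"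
  shows "norm (k * k) = (norm k)\<^sup>2"
  using cstar_identity[of k] assms by simp

text \<open>An inequality, because the norm of \<open>1\<close> is \<open>0\<close> in the zero algebra.\<close>

lemma norm_one_le: "norm (1::'a::unital_cstar_algebra) \<le> 1"
proof -
  have "norm (1::'a) = (norm (1::'a))\<^sup>2"
    using cstar_identity[of "1::'a"] by (simp add: star_one)
  then have "norm (1::'a) * (norm (1::'a) - 1) = 0"
    by (simp add: power2_eq_square algebra_simps)
  then show ?thesis
    by auto
qed

lemma bounded_linear_star: "bounded_linear (star :: 'a::cstar_algebra \<Rightarrow> 'a)"
  by (rule bounded_linear_intro[where K = 1]) (simp_all add: star_add star_scaleR norm_star)

section \<open>Square roots\<close>

text \<open>If \<open>(1 - v)\<^sup>2 = 1 - u\<close>, then \<open>v = (u + v\<^sup>2) / 2\<close>. The square root of \<open>1 - u\<close> is found by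
  iterating this fixed-point equation from \<open>0\<close>. Each iterate is a polynomial in \<open>u\<close> without constant term, which is
  why the limit lies in every C*-subalgebra that contains \<open>u\<close> and commutes with whatever commutes
  with \<open>u\<close>.\<close>

primrec sqrt_approx :: "'a::cstar_algebra \<Rightarrow> nat \<Rightarrow> 'a" where
  "sqrt_approx u 0 = 0"
| "sqrt_approx u (Suc n) = (1/2) *\<^sub>R (u + sqrt_approx u n * sqrt_approx u n)"

text \<open>The same iteration for the number \<open>u = 1\<close>. It majorizes the iteration for any \<open>u\<close> in the unit
  ball, step by step, since all coefficients of the polynomials are nonnegative. Being increasing
  and bounded, it makes the other one converge even on the boundary \<open>norm u = 1\<close>, where the
  iteration is not a contraction.\<close>

primrec sqrt_bound :: "nat \<Rightarrow> real" where
  "sqrt_bound 0 = 0"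
| "sqrt_bound (Suc n) = (1 + sqrt_bound n * sqrt_bound n) / 2"

lemma sqrt_bound_bounds: "0 \<le> sqrt_bound n \<and> sqrt_bound n \<le> 1"
proof (induction n)
  case (Suc n)
  then have "sqrt_bound n * sqrt_bound n \<le> 1"
    by (simp add: mult_le_one)
  then show ?case
    by simp
qed simp

lemma sqrt_bound_mono: "sqrt_bound n \<le> sqrt_bound (Suc n)"
  using zero_le_square[of "1 - sqrt_bound n"] by (simp add: algebra_simps)

lemma sqrt_bound_convergent: "convergent sqrt_bound"
proof (rule Bseq_mono_convergent)
  show "Bseq sqrt_bound"
    by (rule BseqI'[where K = 1]) (use sqrt_bound_bounds in auto)
  show "\<forall>m n. m \<le> n \<longrightarrow> sqrt_bound m \<le> sqrt_bound n"
    using lift_Suc_mono_le[of sqrt_bound] sqrt_bound_mono by blast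
qed

lemma sqrt_approx_commute:
  assumes "c * u = u * c"
  shows "c * sqrt_approx u n = sqrt_approx u n * c"
proof (induction n)
  case (Suc n)
  have "c * (sqrt_approx u n * sqrt_approx u n) = sqrt_approx u n * sqrt_approx u n * c"
    by (metis Suc mult.assoc)
  with assms show ?case
    by (simp add: distrib_left distrib_right)
qed simp

lemma sqrt_approx_mem:
  assumes "cstar_subalgebra S" and "u \<in> S"
  shows "sqrt_approx u n \<in> S"
proof (induction n)
  case 0
  show ?case using assms by (simp add: cstar_subalgebra_def)
next
  case (Suc n)
  then show ?case
    using assms scaleC_of_real[of "1/2" "u + sqrt_approx u n * sqrt_approx u n"]
    unfolding cstar_subalgebra_def by (metis sqrt_approx.simps(2))
qed

lemma norm_sqrt_approx:
  assumes "norm u \<le> 1"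
  shows "norm (sqrt_approx u n) \<le> sqrt_bound n"
proof (induction n)
  case (Suc n)
  have "norm (sqrt_approx u n * sqrt_approx u n) \<le> sqrt_bound n * sqrt_bound n"
    by (meson Suc mult_mono norm_ge_zero norm_mult_ineq order_trans sqrt_bound_bounds)
  then have "norm (u + sqrt_approx u n * sqrt_approx u n) \<le> 1 + sqrt_bound n * sqrt_bound n"
    using assms norm_triangle_ineq[of u "sqrt_approx u n * sqrt_approx u n"] by linarith
  then show ?case
    by simp
qed simp

text \<open>Consecutive iterates commute, so the difference of their squares factors, for \<open>u\<close> just as
  for the numerical majorant.\<close>

lemma norm_sqrt_approx_step:
  assumes "norm u \<le> 1"
  shows "norm (sqrt_approx u (Suc n) - sqrt_approx u n) \<le> sqrt_bound (Suc n) - sqrt_bound n"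
proof (induction n)
  case 0
  show ?case using assms by simp
next
  case (Suc n)
  let ?x = "sqrt_approx u (Suc n)" and ?y = "sqrt_approx u n"
  let ?s = "sqrt_bound (Suc n)" and ?t = "sqrt_bound n"
  have comm: "?x * ?y = ?y * ?x"
    by (metis sqrt_approx_commute)
  have eq: "sqrt_approx u (Suc (Suc n)) - ?x = (1/2) *\<^sub>R ((?x - ?y) * (?x + ?y))"
  proof -
    have "(?x - ?y) * (?x + ?y) = ?x * ?x - ?y * ?y"
      using comm by (simp only: distrib_left left_diff_distrib) simp
    moreover have "sqrt_approx u (Suc (Suc n)) - ?x = (1/2) *\<^sub>R (?x * ?x - ?y * ?y)"
      by (simp only: sqrt_approx.simps(2)[of u "Suc n"] sqrt_approx.simps(2)[of u n]
          scaleR_diff_right[symmetric]) simp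
    ultimately show ?thesis by simp
  qed
  have "norm (?x + ?y) \<le> ?s + ?t"
    using norm_triangle_ineq[of ?x ?y] norm_sqrt_approx[OF assms, of "Suc n"]
      norm_sqrt_approx[OF assms, of n] by linarith
  then have "norm ((?x - ?y) * (?x + ?y)) \<le> (?s - ?t) * (?s + ?t)"
    by (smt (verit) Suc mult_mono norm_ge_zero norm_mult_ineq)
  moreover have "sqrt_bound (Suc (Suc n)) - ?s = ((?s - ?t) * (?s + ?t)) / 2"
    by (simp only: sqrt_bound.simps(2)[of "Suc n"] sqrt_bound.simps(2)[of n])
      (simp add: field_simps)
  ultimately show ?case
    unfolding eq by simp
qed

lemma sqrt_approx_convergent:
  assumes "norm u \<le> 1"
  shows "convergent (sqrt_approx u)"
proof -
  have "summable (\<lambda>n. sqrt_bound (Suc n) - sqrt_bound n)"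
    by (rule telescope_summable) (use sqrt_bound_convergent convergent_LIMSEQ_iff in blast)
  then have "summable (\<lambda>n. sqrt_approx u (Suc n) - sqrt_approx u n)"
    using norm_sqrt_approx_step[OF assms] by (rule summable_comparison_test')
  then have "convergent (\<lambda>n. \<Sum>k<n. sqrt_approx u (Suc k) - sqrt_approx u k)"
    by (rule summable_iff_convergent[THEN iffD1])
  then show ?thesis
    by (simp add: sum_lessThan_telescope del: sqrt_approx.simps(2))
qed

lemma sqrt_one_minus:
  fixes u :: "'a::unital_cstar_algebra"
  assumes "star u = u" and "norm u \<le> 1"
  obtains v where "star v = v" and "norm v \<le> 1" and "(1 - v) * (1 - v) = 1 - u"
    and "\<And>c. c * u = u * c \<Longrightarrow> c * v = v * c"
    and "\<And>S. cstar_subalgebra S \<Longrightarrow> u \<in> S \<Longrightarrow> v \<in> S"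
proof -
  obtain v where v: "sqrt_approx u \<longlonglongrightarrow> v"
    using sqrt_approx_convergent[OF assms(2)] by (auto simp: convergent_def)
  have star_approx: "star (sqrt_approx u n) = sqrt_approx u n" for n
    by (induction n) (simp_all add: star_zero star_scaleR star_add star_mult assms(1))
  have "(\<lambda>n. star (sqrt_approx u n)) \<longlonglongrightarrow> star v"
    by (rule bounded_linear.tendsto[OF bounded_linear_star v])
  then have 1: "star v = v"
    using LIMSEQ_unique v by (simp add: star_approx)
  have 2: "norm v \<le> 1"
    by (rule LIMSEQ_le_const2[OF tendsto_norm[OF v]])
      (use norm_sqrt_approx[OF assms(2)] sqrt_bound_bounds order_trans in blast)
  have "(\<lambda>n. sqrt_approx u (Suc n)) \<longlonglongrightarrow> (1/2) *\<^sub>R (u + v * v)"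
    unfolding sqrt_approx.simps by (intro tendsto_intros v)
  then have "v = (1/2) *\<^sub>R (u + v * v)"
    using LIMSEQ_unique LIMSEQ_Suc[OF v] by blast
  then have "2 *\<^sub>R v = 2 *\<^sub>R (1/2) *\<^sub>R (u + v * v)"
    by simp
  then have "v + v = u + v * v"
    by (simp add: scaleR_2)
  then have 3: "(1 - v) * (1 - v) = 1 - u"
    by (simp add: algebra_simps)
  have 4: "c * v = v * c" if "c * u = u * c" for c
  proof -
    have "(\<lambda>n. c * sqrt_approx u n) \<longlonglongrightarrow> c * v" "(\<lambda>n. sqrt_approx u n * c) \<longlonglongrightarrow> v * c"
      by (intro tendsto_intros v)+
    then show ?thesis
      using LIMSEQ_unique by (simp add: sqrt_approx_commute[OF that])
  qed
  have 5: "v \<in> S" if "cstar_subalgebra S" and "u \<in> S" for S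
    by (rule closed_sequentially[OF _ _ v])
      (use that sqrt_approx_mem[OF that] in \<open>auto simp: cstar_subalgebra_def\<close>)
  show thesis
    using that 1 2 3 4 5 by blast
qed

section \<open>Positive elements\<close>

text \<open>This is positivity in the C*-algebra sense; that \<open>star x * x\<close> is also of this form, for any \<open>x\<close>,
  is proved below.\<close>

definition cstar_positive :: "'a::cstar_algebra \<Rightarrow> bool" where
  "cstar_positive h \<longleftrightarrow> (\<exists>k. star k = k \<and> h = k * k)"

lemma cstar_positive_self_adjoint: "cstar_positive h \<Longrightarrow> star h = h"
  by (auto simp: cstar_positive_def star_mult)

lemma cstar_positive_zero: "cstar_positive 0"
  unfolding cstar_positive_def using star_zero by fastforce

lemma cstar_positive_scaleR:
  assumes "cstar_positive h" and "0 \<le> c"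
  shows "cstar_positive (c *\<^sub>R h)"
proof -
  obtain k where k: "star k = k" "h = k * k"
    using assms(1) by (auto simp: cstar_positive_def)
  have "c *\<^sub>R h = (sqrt c *\<^sub>R k) * (sqrt c *\<^sub>R k)"
    using k assms(2) by simp
  moreover have "star (sqrt c *\<^sub>R k) = sqrt c *\<^sub>R k"
    using k by (simp add: star_scaleR)
  ultimately show ?thesis
    unfolding cstar_positive_def by blast
qed

text \<open>With \<open>s\<close> the square root of \<open>1 - k\<^sup>2\<close>, the element \<open>k + \<i> s\<close> is unitary, as \<open>cos + \<i> sin\<close>
  would be; its imaginary part \<open>s\<close> therefore has norm at most \<open>1\<close>, and so has \<open>s\<^sup>2 = 1 - k\<^sup>2\<close>.\<close>

lemma norm_one_minus_square_le:
  fixes k :: "'a::unital_cstar_algebra"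
  assumes "star k = k" and "norm (k * k) \<le> 1"
  shows "norm (1 - k * k) \<le> 1"
proof -
  have "star (k * k) = k * k"
    using assms(1) by (simp add: star_mult)
  then obtain v where v: "star v = v" "(1 - v) * (1 - v) = 1 - k * k"
    and comm: "\<And>c. c * (k * k) = k * k * c \<Longrightarrow> c * v = v * c"
    using sqrt_one_minus[OF _ assms(2)] by metis
  define s where "s = 1 - v"
  have s: "star s = s" "s * s = 1 - k * k"
    using v by (simp_all add: s_def star_diff star_one)
  have ks: "k * s = s * k"
    using comm[of k] by (simp add: s_def algebra_simps)
  define w where "w = k + \<i> *\<^sub>C s"
  have star_w: "star w = k - \<i> *\<^sub>C s"
    using scaleC_scaleC[of "-1" \<i> s]
    by (simp add: w_def star_add star_scaleC s assms(1) scaleC_minus_one)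
  have "star w * w = (k - \<i> *\<^sub>C s) * (k + \<i> *\<^sub>C s)"
    by (simp only: star_w) (simp only: w_def)
  also have "\<dots> = k * k - (\<i> *\<^sub>C s) * (\<i> *\<^sub>C s)"
    by (simp add: distrib_left left_diff_distrib mult_scaleC_left mult_scaleC_right
        scaleC_diff_right ks)
  also have "(\<i> *\<^sub>C s) * (\<i> *\<^sub>C s) = - (s * s)"
    by (simp add: mult_scaleC_left mult_scaleC_right scaleC_scaleC scaleC_minus_one)
  finally have "star w * w = 1"
    by (simp add: s)
  then have "(norm w)\<^sup>2 \<le> 1"
    using cstar_identity[of w] norm_one_le[where 'a = 'a] by simp
  then have w1: "norm w \<le> 1"
    by (simp add: power2_le_iff_abs_le abs_square_le_1)
  have "2 *\<^sub>R (\<i> *\<^sub>C s) = w - star w"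
    unfolding star_w unfolding w_def by (simp add: scaleR_2)
  then have "2 * norm (\<i> *\<^sub>C s) = norm (w - star w)"
    by (metis abs_numeral norm_scaleR)
  also have "\<dots> \<le> 2"
    using norm_triangle_ineq4[of w "star w"] w1 by (simp add: norm_star)
  finally have "norm s \<le> 1"
    by (simp add: norm_scaleC)
  then have "norm (s * s) \<le> 1"
    by (simp add: norm_self_adjoint_square[OF s(1)] power_le_one)
  then show ?thesis
    by (simp add: s)
qed

lemma cstar_positive_norm:
  fixes h :: "'a::unital_cstar_algebra"
  assumes "cstar_positive h" and "norm h \<le> t"
  shows "norm (t *\<^sub>R 1 - h) \<le> t"
proof (cases "t = 0")
  case True
  then show ?thesis using assms(2) by simp
next
  case False
  then have t: "t > 0"
    using assms(2) norm_ge_zero[of h] by linarith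
  obtain k where k: "star k = k" "(1/t) *\<^sub>R h = k * k"
    using cstar_positive_scaleR[OF assms(1), of "1/t"] t by (auto simp: cstar_positive_def)
  have "norm ((1/t) *\<^sub>R h) \<le> 1"
    using t assms(2) by simp
  then have "norm (1 - (1/t) *\<^sub>R h) \<le> 1"
    using norm_one_minus_square_le[OF k(1)] k(2) by simp
  moreover have "t *\<^sub>R 1 - h = t *\<^sub>R (1 - (1/t) *\<^sub>R h)"
    using t by (simp add: scaleR_diff_right)
  ultimately show ?thesis
    using t by (simp add: mult_le_cancel_left1)
qed

text \<open>The third conclusion is the hypothesis again, for \<open>k\<close> in place of \<open>h\<close>: the root is itself
  positive, and the construction can be repeated to get a fourth root.\<close>

lemma positive_square_root:
  fixes h :: "'a::unital_cstar_algebra"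
  assumes "star h = h" and "norm (t *\<^sub>R 1 - h) \<le> t"
  obtains k where "star k = k" and "k * k = h" and "norm (sqrt t *\<^sub>R 1 - k) \<le> sqrt t"
    and "\<And>c. c * h = h * c \<Longrightarrow> c * k = k * c"
proof (cases "t = 0")
  case True
  then have "h = 0" using assms(2) by simp
  then show ?thesis using that[of 0] True by (simp add: star_zero)
next
  case False
  then have t: "t > 0"
    using assms(2) norm_ge_zero[of "t *\<^sub>R 1 - h"] by linarith
  define u where "u = 1 - (1/t) *\<^sub>R h"
  have u: "star u = u"
    by (simp add: u_def star_diff star_one star_scaleR assms(1))
  have "u = (1/t) *\<^sub>R (t *\<^sub>R 1 - h)"
    using t by (simp add: u_def scaleR_diff_right)
  then have "norm u \<le> 1"
    using t assms(2) by simp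
  then obtain v where v: "star v = v" "norm v \<le> 1" "(1 - v) * (1 - v) = 1 - u"
    and comm: "\<And>c. c * u = u * c \<Longrightarrow> c * v = v * c"
    using sqrt_one_minus[OF u] by metis
  define k where "k = sqrt t *\<^sub>R (1 - v)"
  have "star k = k"
    by (simp add: k_def star_scaleR star_diff star_one v)
  moreover have "k * k = h"
    using t by (simp add: k_def v(3)) (simp add: u_def)
  moreover have "sqrt t *\<^sub>R 1 - k = sqrt t *\<^sub>R v"
    by (simp add: k_def scaleR_diff_right)
  then have "norm (sqrt t *\<^sub>R 1 - k) \<le> sqrt t"
    using v(2) t by (simp add: mult_le_cancel_left1)
  moreover have "c * k = k * c" if "c * h = h * c" for c
  proof -
    have "c * u = u * c"
      using that by (simp add: u_def algebra_simps)
    then show ?thesis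
      using comm[of c] by (simp add: k_def algebra_simps)
  qed
  ultimately show ?thesis using that by blast
qed

lemma cstar_positiveI_norm:
  fixes h :: "'a::unital_cstar_algebra"
  assumes "star h = h" and "norm (t *\<^sub>R 1 - h) \<le> t"
  shows "cstar_positive h"
  using positive_square_root[OF assms] unfolding cstar_positive_def by metis

lemma cstar_positive_add:
  fixes g h :: "'a::unital_cstar_algebra"
  assumes "cstar_positive g" and "cstar_positive h"
  shows "cstar_positive (g + h)"
proof (rule cstar_positiveI_norm)
  show "star (g + h) = g + h"
    using assms by (simp add: star_add cstar_positive_self_adjoint)
  have eq: "(norm g + norm h) *\<^sub>R 1 - (g + h) = (norm g *\<^sub>R 1 - g) + (norm h *\<^sub>R 1 - h)"
    by (simp add: scaleR_add_left)
  then show "norm ((norm g + norm h) *\<^sub>R 1 - (g + h)) \<le> norm g + norm h"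
    unfolding eq using norm_triangle_ineq[of "norm g *\<^sub>R 1 - g" "norm h *\<^sub>R 1 - h"]
      cstar_positive_norm[OF assms(1) order_refl] cstar_positive_norm[OF assms(2) order_refl]
    by linarith
qed

lemma cstar_positive_sum:
  fixes f :: "'b \<Rightarrow> 'a::unital_cstar_algebra"
  assumes "\<And>i. i \<in> A \<Longrightarrow> cstar_positive (f i)"
  shows "cstar_positive (sum f A)"
  using assms by (induction A rule: infinite_finite_induct)
    (simp_all add: cstar_positive_zero cstar_positive_add)

text \<open>Quantifies that \<open>h\<close> and \<open>- h\<close> are both positive only for \<open>h = 0\<close>, using
  \<open>(t + h)\<^sup>2 - (t - h)\<^sup>2 = 4 t h\<close>. It serves both antisymmetry of the order and the
  boundedness of positive maps.\<close>

lemma norm_le_of_between: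
  fixes h :: "'a::unital_cstar_algebra"
  assumes "norm (t *\<^sub>R 1 + h) \<le> T" and "norm (t *\<^sub>R 1 - h) \<le> T" and "0 \<le> t"
  shows "2 * t * norm h \<le> T\<^sup>2"
proof -
  let ?p = "t *\<^sub>R 1 + h" and ?m = "t *\<^sub>R 1 - h"
  have "?p * ?p - ?m * ?m = t *\<^sub>R h + t *\<^sub>R h + t *\<^sub>R h + t *\<^sub>R h"
    by (simp add: algebra_simps)
  also have "\<dots> = (4 * t) *\<^sub>R h"
    by (simp flip: scaleR_left_distrib)
  finally have "?p * ?p - ?m * ?m = (4 * t) *\<^sub>R h" .
  then have "4 * t * norm h = norm (?p * ?p - ?m * ?m)"
    using assms(3) by simp
  also have "\<dots> \<le> norm ?p * norm ?p + norm ?m * norm ?m"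
    by (meson add_mono norm_mult_ineq norm_triangle_ineq4 order_trans)
  also have "\<dots> \<le> T * T + T * T"
    using assms by (intro add_mono mult_mono) (auto intro: order_trans[OF norm_ge_zero])
  finally show ?thesis
    by (simp add: power2_eq_square)
qed

lemma cstar_positive_antisym:
  fixes h :: "'a::unital_cstar_algebra"
  assumes "cstar_positive h" and "cstar_positive (- h)"
  shows "h = 0"
proof -
  have "2 * norm h * norm h \<le> (norm h)\<^sup>2"
    using cstar_positive_norm[OF assms(1) order_refl] cstar_positive_norm[OF assms(2), of "norm h"]
    by (intro norm_le_of_between) auto
  then show ?thesis
    by (simp add: power2_eq_square) (smt (verit) mult_pos_pos zero_less_norm_iff)
qed

text \<open>The sharp bound is \<open>1\<close>; any constant suffices for the continuity of positive maps.\<close>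

lemma norm_le_3_of_between_one:
  fixes h :: "'a::unital_cstar_algebra"
  assumes "cstar_positive (1 + h)" and "cstar_positive (1 - h)"
  shows "norm h \<le> 3"
proof -
  have *: "norm (1 + h) \<le> 1 + norm h" "norm (1 - h) \<le> 1 + norm h"
    using norm_triangle_ineq[of 1 h] norm_triangle_ineq4[of 1 h] norm_one_le[where 'a = 'a] by auto
  have "norm ((1 + norm h) *\<^sub>R 1 - (1 - h)) \<le> 1 + norm h"
    "norm ((1 + norm h) *\<^sub>R 1 - (1 + h)) \<le> 1 + norm h"
    by (rule cstar_positive_norm[OF assms(2) *(2)] cstar_positive_norm[OF assms(1) *(1)])+
  then have "2 * norm h * norm h \<le> (1 + norm h)\<^sup>2"
    by (intro norm_le_of_between) (simp_all add: scaleR_add_left)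
  then have "norm h * (norm h - 2) \<le> 1"
    by (simp add: power2_eq_square algebra_simps)
  show ?thesis
  proof (rule ccontr)
    assume "\<not> norm h \<le> 3"
    then have "1 * 1 < norm h * (norm h - 2)"
      by (intro mult_strict_mono) auto
    with \<open>norm h * (norm h - 2) \<le> 1\<close> show False by simp
  qed
qed

text \<open>In terms of the real and imaginary parts of \<open>z\<close>, the sum is twice the sum of their
  squares.\<close>

lemma cstar_positive_star_mult_add_mult_star:
  fixes z :: "'a::unital_cstar_algebra"
  shows "cstar_positive (star z * z + z * star z)"
proof -
  let ?p = "z + star z" and ?q = "\<i> *\<^sub>C (z - star z)"
  have "star ?q = (-1) *\<^sub>C \<i> *\<^sub>C (- (z - star z))"
    by (simp add: star_scaleC star_diff star_star scaleC_scaleC)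
  then have "star ?q = ?q"
    by (simp only: scaleC_minus_right scaleC_minus_one minus_minus)
  moreover have "star ?p = ?p"
    by (simp add: star_add star_star add.commute)
  ultimately have pos: "cstar_positive ((1/2) *\<^sub>R (?p * ?p + ?q * ?q))"
    by (intro cstar_positive_scaleR cstar_positive_add) (auto simp: cstar_positive_def)
  have "?q * ?q = - ((z - star z) * (z - star z))"
    by (simp add: mult_scaleC_left mult_scaleC_right scaleC_scaleC scaleC_minus_one)
  then have "?p * ?p + ?q * ?q = 2 *\<^sub>R (star z * z + z * star z)"
    by (simp add: algebra_simps scaleR_2)
  then show ?thesis
    using pos by simp
qed

text \<open>For self-adjoint \<open>y\<close> this is antisymmetry of the order. In general, let \<open>p = - star y * y\<close>
  have the root \<open>k\<close> and put \<open>z = y * k\<close>. Then \<open>star z * z = - p\<^sup>2\<close>, and \<open>z * star z\<close> is again minus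
  a square, whereas their sum is positive by the previous lemma. Hence all these squares
  vanish.\<close>

lemma eq_0_if_minus_star_mult_positive:
  fixes y :: "'a::unital_cstar_algebra"
  assumes "cstar_positive (- (star y * y))"
  shows "y = 0"
proof -
  define p q where "p = - (star y * y)" and "q = y * star y"
  obtain k where k: "star k = k" "p = k * k"
    using assms by (auto simp: cstar_positive_def p_def)
  have sa: "star p = p" "star q = q"
    by (simp_all add: p_def q_def star_minus star_mult star_star)
  define z where "z = y * k"
  have "star z * z = k * (star y * y) * k"
    by (simp add: z_def star_mult k mult.assoc)
  also have "\<dots> = - (p * p)"
    unfolding minus_equation_iff[THEN iffD1, OF p_def[symmetric], symmetric]
    by (simp add: k(2) mult.assoc)
  finally have 1: "star z * z = - (p * p)" .
  have "z * star z = y * p * star y"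
    by (simp add: z_def star_mult k mult.assoc)
  also have "\<dots> = - (q * q)"
    by (simp add: p_def q_def mult.assoc)
  finally have 2: "z * star z = - (q * q)" .
  have pos: "cstar_positive (p * p)" "cstar_positive (q * q)"
    using sa by (auto simp: cstar_positive_def)
  then have "cstar_positive (p * p + q * q)"
    by (rule cstar_positive_add)
  moreover have "cstar_positive (- (p * p + q * q))"
    using cstar_positive_star_mult_add_mult_star[of z] 1 2 by simp
  ultimately have "p * p + q * q = 0"
    by (rule cstar_positive_antisym)
  then have "- (p * p) = q * q"
    by (simp add: minus_unique)
  then have "p * p = 0"
    using pos cstar_positive_antisym by metis
  then have "p = 0"
    using star_mult_eq_0_iff[of p] sa by simp
  then show ?thesis
    using star_mult_eq_0_iff[of y] by (simp add: p_def)
qed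

text \<open>The theorem of Fukamiya and Kaplansky. Let \<open>h = star x * x\<close>, let \<open>m\<close> be its absolute value, the root
  of \<open>h\<^sup>2\<close>, and let \<open>c = m - h\<close>, which is twice the negative part of \<open>h\<close>. Since \<open>h c = - m c\<close>, the
  element \<open>star (x * c) * (x * c) = c h c\<close> is minus a square, so \<open>x * c = 0\<close>
  by \<open>eq_0_if_minus_star_mult_positive\<close>. This forces \<open>c = 0\<close>, that is, \<open>h = m\<close>, and \<open>m\<close> is positive.\<close>

lemma cstar_positive_star_mult:
  fixes x :: "'a::unital_cstar_algebra"
  shows "cstar_positive (star x * x)"
proof -
  define h where "h = star x * x"
  have h: "star h = h"
    by (simp add: h_def star_mult star_star)
  have hh: "star (h * h) = h * h"
    by (simp add: star_mult h)
  have "cstar_positive (h * h)"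
    using h unfolding cstar_positive_def by blast
  then obtain t where "norm (t *\<^sub>R 1 - h * h) \<le> t"
    using cstar_positive_norm by blast
  then obtain m where m: "star m = m" "m * m = h * h" "norm (sqrt t *\<^sub>R 1 - m) \<le> sqrt t"
    and m_comm: "\<And>c. c * (h * h) = h * h * c \<Longrightarrow> c * m = m * c"
    using positive_square_root[OF hh] by blast
  obtain r where r: "star r = r" "r * r = m"
    and r_comm: "\<And>c. c * m = m * c \<Longrightarrow> c * r = r * c"
    using positive_square_root[OF m(1,3)] by blast
  have hm: "h * m = m * h"
    by (rule m_comm) (simp add: mult.assoc)
  define c where "c = m - h"
  have c: "star c = c"
    by (simp add: c_def star_diff m h)
  have cm: "c * m = m * c"
    by (simp add: c_def algebra_simps hm)
  have cr: "c * r = r * c"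
    by (rule r_comm[OF cm])
  have ch: "h * c = - (m * c)"
    by (simp add: c_def algebra_simps hm m(2))
  have "c * h * c = - ((r * c) * (r * c))"
  proof -
    have "c * h * c = - (c * (m * c))"
      by (simp add: mult.assoc ch)
    also have "c * (m * c) = (c * r) * (r * c)"
      by (simp add: r(2)[symmetric] mult.assoc)
    finally show ?thesis by (simp add: cr)
  qed
  moreover have "star (x * c) * (x * c) = c * h * c"
    by (simp add: h_def star_mult c mult.assoc)
  moreover have rc: "star (r * c) = r * c"
    by (simp add: star_mult c r cr)
  ultimately have "cstar_positive (- (star (x * c) * (x * c)))"
    unfolding cstar_positive_def by (metis minus_minus)
  then have "x * c = 0"
    by (rule eq_0_if_minus_star_mult_positive)
  then have "h * c = 0"
    by (simp add: h_def mult.assoc)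
  then have "m * c = 0"
    using ch by simp
  then have "c * c = 0"
    using \<open>h * c = 0\<close> unfolding c_def by (simp add: left_diff_distrib)
  then have "c = 0"
    using star_mult_eq_0_iff[of c] c by simp
  then have "h = r * r"
    by (simp add: c_def r)
  then show ?thesis
    using r(1) unfolding cstar_positive_def h_def by blast
qed

lemma sum_star_mult_eq_0:
  fixes w :: "'b \<Rightarrow> 'a::unital_cstar_algebra"
  assumes "finite A" and "(\<Sum>i\<in>A. star (w i) * w i) = 0" and "j \<in> A"
  shows "w j = 0"
proof -
  have "- (star (w j) * w j) = (\<Sum>i\<in>A - {j}. star (w i) * w i)"
    using assms by (simp add: sum.remove minus_unique)
  then have "cstar_positive (- (star (w j) * w j))"
    by (simp add: cstar_positive_sum cstar_positive_star_mult)
  then show ?thesis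
    by (rule eq_0_if_minus_star_mult_positive)
qed

section \<open>Completely positive maps\<close>

lemma cstar_subalgebra_generated: "cstar_subalgebra (cstar_generated X)"
  unfolding cstar_generated_def
  by (rule hull_in) (auto simp: cstar_subalgebra_def intro: closed_Inter)

lemma adjoint_mat_mult_index:
  assumes "Y \<in> carrier_mat n n" and "i < n" and "j < n"
  shows "(adjoint_mat Y * Y) $$ (i, j) = (\<Sum>k<n. star (Y $$ (k, i)) * Y $$ (k, j))"
  using assms by (auto simp: adjoint_mat_def scalar_prod_def atLeast0LessThan intro!: sum.cong)

text \<open>A matrix with \<open>x\<close> as its first row and zeros elsewhere has the Gram matrix with entries
  \<open>star (x\<^sub>i) * x\<^sub>j\<close>. Its image under a completely positive map is a Gram matrix again.\<close>

lemma completely_positive_gram: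
  fixes n :: nat
  assumes cp: "completely_positive_on B \<Phi>" and B: "0 \<in> B" and x: "\<And>i. i < n \<Longrightarrow> x i \<in> B"
  obtains z where "\<And>i j. i < n \<Longrightarrow> j < n \<Longrightarrow>
    \<Phi> (star (x i) * x j) = (\<Sum>k<n. star (z k i) * z k j)"
proof -
  define Y where "Y = mat n n (\<lambda>(k, i). if k = 0 then x i else 0)"
  have Y: "Y \<in> carrier_mat n n" "elements_mat Y \<subseteq> B"
    using x B by (auto simp: Y_def elements_mat_def)
  have Y_gram: "(adjoint_mat Y * Y) $$ (i, j) = star (x i) * x j" if "i < n" "j < n" for i j
  proof -
    have "(adjoint_mat Y * Y) $$ (i, j) = (\<Sum>k<n. if k = 0 then star (x i) * x j else 0)"
      unfolding adjoint_mat_mult_index[OF Y(1) that] using that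
      by (intro sum.cong) (auto simp: Y_def star_zero)
    then show ?thesis using that by simp
  qed
  have "adjoint_mat Y * Y \<in> positive_mats n B"
    using Y unfolding positive_mats_def by blast
  then have "map_mat \<Phi> (adjoint_mat Y * Y) \<in> positive_mats n UNIV"
    using cp unfolding completely_positive_on_def by blast
  then obtain Z where Z: "Z \<in> carrier_mat n n"
    "map_mat \<Phi> (adjoint_mat Y * Y) = adjoint_mat Z * Z"
    unfolding positive_mats_def by blast
  have "\<Phi> (star (x i) * x j) = (\<Sum>k<n. star (Z $$ (k, i)) * Z $$ (k, j))"
    if "i < n" "j < n" for i j
  proof -
    have "\<Phi> ((adjoint_mat Y * Y) $$ (i, j)) = map_mat \<Phi> (adjoint_mat Y * Y) $$ (i, j)"
      using that Y(1) by (simp add: adjoint_mat_def)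
    then show ?thesis
      using that by (simp only: Y_gram Z(2) adjoint_mat_mult_index[OF Z(1)])
  qed
  then show thesis
    by (rule that[of "\<lambda>k i. Z $$ (k, i)"])
qed

lemma completely_positive_star_mult:
  fixes \<Phi> :: "'a::cstar_algebra \<Rightarrow> 'b::unital_cstar_algebra"
  assumes "completely_positive_on B \<Phi>" and "0 \<in> B" and "x \<in> B"
  shows "cstar_positive (\<Phi> (star x * x))"
proof -
  obtain z where "\<And>i j. i < 1 \<Longrightarrow> j < 1 \<Longrightarrow>
    \<Phi> (star x * x) = (\<Sum>k<(1::nat). star (z k i) * z k (j::nat) :: 'b)"
    using completely_positive_gram[OF assms(1,2), of 1 "\<lambda>_. x"] assms(3) by blast
  then have "\<Phi> (star x * x) = star (z 0 0) * z 0 0"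
    by simp
  then show ?thesis
    by (simp add: cstar_positive_star_mult)
qed

section \<open>Unital completely positive maps on a C*-subalgebra\<close>

locale unital_cp_map =
  fixes B :: "'a::unital_cstar_algebra set" and \<Phi> :: "'a \<Rightarrow> 'b::unital_cstar_algebra"
  assumes subalgebra: "cstar_subalgebra B" and one_mem: "1 \<in> B"
    and linear: "complex_linear \<Phi>" and unital: "\<Phi> 1 = 1"
    and cp: "completely_positive_on B \<Phi>"
begin

lemma mem:
  "0 \<in> B" "x \<in> B \<Longrightarrow> y \<in> B \<Longrightarrow> x + y \<in> B" "x \<in> B \<Longrightarrow> c *\<^sub>C x \<in> B"
  "x \<in> B \<Longrightarrow> y \<in> B \<Longrightarrow> x * y \<in> B" "x \<in> B \<Longrightarrow> star x \<in> B" "closed B"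
  using subalgebra by (auto simp: cstar_subalgebra_def)

lemma mem_scaleR: "x \<in> B \<Longrightarrow> r *\<^sub>R x \<in> B"
  using mem(3)[of x "complex_of_real r"] by (simp add: scaleC_of_real)

lemma mem_diff: "x \<in> B \<Longrightarrow> y \<in> B \<Longrightarrow> x - y \<in> B"
  using mem(2)[of x "- y"] mem_scaleR[of y "-1"] by simp

lemma map_add: "\<Phi> (x + y) = \<Phi> x + \<Phi> y"
  and map_scaleC: "\<Phi> (c *\<^sub>C x) = c *\<^sub>C \<Phi> x"
  using linear by (auto simp: complex_linear_def)

lemma map_scaleR: "\<Phi> (r *\<^sub>R x) = r *\<^sub>R \<Phi> x"
  using map_scaleC[of "complex_of_real r" x] by (simp add: scaleC_of_real)

lemma map_diff: "\<Phi> (x - y) = \<Phi> x - \<Phi> y"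
  using map_add[of x "- y"] map_scaleR[of "-1" y] by simp

lemma map_self_adjoint: "x \<in> B \<Longrightarrow> star (\<Phi> (star x * x)) = \<Phi> (star x * x)"
  by (rule cstar_positive_self_adjoint) (rule completely_positive_star_mult[OF cp mem(1)])

text \<open>Compare the self-adjoint values of \<open>\<Phi>\<close> at \<open>star (1 + y) * (1 + y)\<close> and \<open>star y * y\<close>: the cross term
  \<open>\<Phi> y + \<Phi> (star y)\<close> is self-adjoint. Doing so for \<open>x\<close> and for \<open>\<i> x\<close> separates the two
  summands.\<close>

lemma map_star:
  assumes "x \<in> B"
  shows "\<Phi> (star x) = star (\<Phi> x)"
proof -
  have polar: "star (\<Phi> y) + star (\<Phi> (star y)) = \<Phi> y + \<Phi> (star y)" if "y \<in> B" for y
  proof -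
    have "star (1 + y) * (1 + y) = 1 + (y + star y) + star y * y"
      by (simp add: star_add star_one algebra_simps)
    then have "\<Phi> (star (1 + y) * (1 + y)) = 1 + (\<Phi> y + \<Phi> (star y)) + \<Phi> (star y * y)"
      by (simp add: map_add unital)
    then show ?thesis
      using map_self_adjoint[of "1 + y"] map_self_adjoint[OF that] mem(2)[OF one_mem that]
      by (simp add: star_add star_one)
  qed
  have "star (\<Phi> (\<i> *\<^sub>C x)) + star (\<Phi> (star (\<i> *\<^sub>C x))) = \<Phi> (\<i> *\<^sub>C x) + \<Phi> (star (\<i> *\<^sub>C x))"
    by (rule polar) (rule mem(3)[OF assms])
  then have "\<i> *\<^sub>C ((- \<i>) *\<^sub>C star (\<Phi> x) + \<i> *\<^sub>C star (\<Phi> (star x)))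
      = \<i> *\<^sub>C (\<i> *\<^sub>C \<Phi> x + (- \<i>) *\<^sub>C \<Phi> (star x))"
    by (simp add: map_scaleC star_scaleC)
  then have "star (\<Phi> x) - star (\<Phi> (star x)) = - \<Phi> x + \<Phi> (star x)"
    by (simp add: scaleC_add_right scaleC_scaleC scaleC_one scaleC_minus_one)
  then have "(star (\<Phi> x) + star (\<Phi> (star x))) + (star (\<Phi> x) - star (\<Phi> (star x)))
      = (\<Phi> x + \<Phi> (star x)) + (- \<Phi> x + \<Phi> (star x))"
    by (simp only: polar[OF assms])
  then have "2 *\<^sub>R star (\<Phi> x) = 2 *\<^sub>R \<Phi> (star x)"
    by (simp add: scaleR_2)
  then show ?thesis by simp
qed

lemma cstar_positive_map_one_minus:
  assumes "h \<in> B" and "star h = h" and "norm h \<le> 1"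
  shows "cstar_positive (1 - \<Phi> h)"
proof -
  obtain v where v: "star v = v" "(1 - v) * (1 - v) = 1 - h" "v \<in> B"
    using sqrt_one_minus[OF assms(2,3)] subalgebra assms(1) by metis
  have "\<Phi> (star (1 - v) * (1 - v)) = 1 - \<Phi> h"
    by (simp add: star_diff star_one v map_diff unital)
  then show ?thesis
    using completely_positive_star_mult[OF cp mem(1) mem_diff[OF one_mem v(3)]] by simp
qed

text \<open>After scaling to \<open>norm h = 1\<close>, the elements \<open>1 + h\<close> and \<open>1 - h\<close> are squares of self-adjoint elements
  of \<open>B\<close>, so their images \<open>1 + \<Phi> h\<close> and \<open>1 - \<Phi> h\<close> are positive.\<close>

lemma norm_map_self_adjoint:
  assumes "h \<in> B" and "star h = h"
  shows "norm (\<Phi> h) \<le> 3 * norm h"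
proof (cases "h = 0")
  case True
  then show ?thesis using map_scaleR[of 0 h] by simp
next
  case False
  define g where "g = (1 / norm h) *\<^sub>R h"
  have g: "g \<in> B" "star g = g" "norm g \<le> 1"
    using assms False by (simp_all add: g_def mem_scaleR star_scaleR)
  have "cstar_positive (1 - \<Phi> g)" "cstar_positive (1 - \<Phi> (- g))"
    using cstar_positive_map_one_minus[OF g] cstar_positive_map_one_minus[of "- g"]
      g mem_scaleR[OF g(1), of "-1"] by (auto simp: star_minus)
  moreover have "1 - \<Phi> (- g) = 1 + \<Phi> g"
    using map_scaleR[of "-1" g] by simp
  ultimately have "norm (\<Phi> g) \<le> 3"
    by (intro norm_le_3_of_between_one) simp_all
  then show ?thesis
    using False by (simp add: g_def map_scaleR field_simps)
qed

lemma norm_map: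
  assumes "x \<in> B"
  shows "norm (\<Phi> x) \<le> 6 * norm x"
proof -
  define p q where "p = x + star x" and "q = \<i> *\<^sub>C (x - star x)"
  have "star q = (-1) *\<^sub>C \<i> *\<^sub>C (- (x - star x))"
    by (simp add: q_def star_scaleC star_diff star_star scaleC_scaleC)
  then have sa: "star q = q" "star p = p"
    by (simp_all only: scaleC_minus_right scaleC_minus_one minus_minus q_def)
      (simp add: p_def star_add star_star add.commute)
  have inB: "p \<in> B" "q \<in> B"
    using assms by (simp_all add: p_def q_def mem mem_diff)
  have np: "norm p \<le> 2 * norm x" "norm q \<le> 2 * norm x"
    using norm_triangle_ineq[of x "star x"] norm_triangle_ineq4[of x "star x"]
    by (simp_all add: p_def q_def norm_scaleC norm_star)
  have "(-\<i>) *\<^sub>C q = x - star x"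
    by (simp add: q_def scaleC_scaleC scaleC_one)
  then have "2 *\<^sub>R x = p + (-\<i>) *\<^sub>C q"
    by (simp add: p_def scaleR_2)
  then have "2 *\<^sub>R \<Phi> x = \<Phi> p + (-\<i>) *\<^sub>C \<Phi> q"
    by (metis map_scaleR map_add map_scaleC)
  then have "2 * norm (\<Phi> x) = norm (\<Phi> p + (-\<i>) *\<^sub>C \<Phi> q)"
    by (metis abs_numeral norm_scaleR)
  also have "\<dots> \<le> norm (\<Phi> p) + norm (\<Phi> q)"
    using norm_triangle_ineq[of "\<Phi> p" "(-\<i>) *\<^sub>C \<Phi> q"] by (simp add: norm_scaleC)
  finally show ?thesis
    using norm_map_self_adjoint[OF inB(1) sa(2)] norm_map_self_adjoint[OF inB(2) sa(1)] np
    by linarith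
qed

lemma tendsto_map:
  assumes "\<And>n. x n \<in> B" and "l \<in> B" and "x \<longlonglongrightarrow> l"
  shows "(\<lambda>n. \<Phi> (x n)) \<longlonglongrightarrow> \<Phi> l"
proof -
  have "(\<lambda>n. 6 * norm (x n - l)) \<longlonglongrightarrow> 0"
    using assms(3) by (intro tendsto_mult_right_zero tendsto_norm_zero) (simp add: LIM_zero)
  then have "(\<lambda>n. \<Phi> (x n) - \<Phi> l) \<longlonglongrightarrow> 0"
    by (rule Lim_null_comparison[rotated])
      (simp add: norm_map mem_diff assms flip: map_diff)
  then show ?thesis
    by (rule LIM_zero_cancel)
qed

text \<open>Choi's theorem: equality in the Schwarz inequality \<open>star (\<Phi> x) * \<Phi> x \<le> \<Phi> (star x * x)\<close> makes \<open>\<Phi>\<close>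
  multiplicative at \<open>star x\<close> from the left.\<close>

lemma map_star_mult_left:
  assumes "x \<in> B" and "b \<in> B" and "\<Phi> (star x * x) = star (\<Phi> x) * \<Phi> x"
  shows "\<Phi> (star x * b) = star (\<Phi> x) * \<Phi> b"
proof -
  define y where "y i = [1, x, b] ! i" for i
  have y: "y 0 = 1" "y 1 = x" "y 2 = b"
    by (simp_all add: y_def numeral_2_eq_2)
  have yB: "y i \<in> B" if "i < 3" for i
  proof -
    from that have "i = 0 \<or> i = 1 \<or> i = 2" by auto
    then show ?thesis using assms(1,2) one_mem y by metis
  qed
  obtain z where z: "\<And>i j. i < 3 \<Longrightarrow> j < 3 \<Longrightarrow>
    \<Phi> (star (y i) * y j) = (\<Sum>k<(3::nat). star (z k i) * z k j)"
    using completely_positive_gram[OF cp mem(1), of 3 y, OF yB] by blast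
  have lt: "0 < (3::nat)" "1 < (3::nat)" "2 < (3::nat)"
    by simp_all
  have G: "(\<Sum>k<3. star (z k 0) * z k 0) = 1" "(\<Sum>k<3. star (z k 0) * z k 1) = \<Phi> x"
    "(\<Sum>k<3. star (z k 1) * z k 0) = star (\<Phi> x)"
    "(\<Sum>k<3. star (z k 1) * z k 1) = star (\<Phi> x) * \<Phi> x"
    "(\<Sum>k<3. star (z k 0) * z k 2) = \<Phi> b" "(\<Sum>k<3. star (z k 1) * z k 2) = \<Phi> (star x * b)"
    by (simp_all only: y star_one unital map_star[OF assms(1)] assms(3) mult_1_left mult_1_right
        flip: z[OF lt(1,1)] z[OF lt(1,2)] z[OF lt(2,1)] z[OF lt(2,2)] z[OF lt(1,3)] z[OF lt(2,3)])
  \<comment> \<open>Column \<open>0\<close> has inner square \<open>\<Phi> 1 = 1\<close>, so \<open>w\<close> is the part of column \<open>1\<close> orthogonal to it.\<close>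
  define w where "w k = z k 1 - z k 0 * \<Phi> x" for k
  have w_left: "(\<Sum>k<3. star (w k) * c k) =
      (\<Sum>k<3. star (z k 1) * c k) - star (\<Phi> x) * (\<Sum>k<3. star (z k 0) * c k)" for c
    by (simp add: w_def star_diff star_mult left_diff_distrib sum_subtractf mult.assoc
        sum_distrib_left)
  have "(\<Sum>k<3. star (w k) * w k) =
      (\<Sum>k<3. star (w k) * z k 1) - (\<Sum>k<3. star (w k) * z k 0) * \<Phi> x"
    unfolding w_def[of k for k]
    by (simp add: right_diff_distrib sum_subtractf mult.assoc sum_distrib_right)
  also have "\<dots> = 0"
    unfolding w_left by (simp only: G) simp
  finally have "w k = 0" if "k < 3" for k
    using sum_star_mult_eq_0[of "{..<3}" w k] that by simp
  then have "(\<Sum>k<3. star (w k) * z k 2) = 0"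
    by (simp add: star_zero)
  then show ?thesis
    unfolding w_left G by simp
qed

end

section \<open>The bimodule domain\<close>

locale unital_cp_self_map = unital_cp_map B \<Phi>
  for B :: "'a::unital_cstar_algebra set" and \<Phi> :: "'a \<Rightarrow> 'a"
begin

text \<open>The elements that may play the role of \<open>a\<close> in the Bimodule Property. Asking for \<open>\<Phi> (x * b) = x * \<Phi> b\<close>
  rather than \<open>\<Phi> x * \<Phi> b\<close> builds fixedness into the definition, so that passing from \<open>a\<close> to the
  algebra it generates yields fixed points at once.\<close>

definition bimodule_domain :: "'a set" where
  "bimodule_domain = {x \<in> B. \<forall>b\<in>B. \<Phi> (x * b) = x * \<Phi> b \<and> \<Phi> (b * x) = \<Phi> b * x}"

lemma bimodule_domain_fixed: "x \<in> bimodule_domain \<Longrightarrow> \<Phi> x = x"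
  unfolding bimodule_domain_def using one_mem unital by force

text \<open>The second part is the adjoint of the first, taken at \<open>star b\<close>.\<close>

lemma fixed_star_mult_left:
  assumes "x \<in> B" and "\<Phi> x = x" and "\<Phi> (star x * x) = star x * x" and "b \<in> B"
  shows "\<Phi> (star x * b) = star x * \<Phi> b" and "\<Phi> (b * x) = \<Phi> b * x"
proof -
  have *: "\<Phi> (star x * b) = star x * \<Phi> b" if "b \<in> B" for b
    using map_star_mult_left[OF assms(1) that] assms by simp
  show "\<Phi> (star x * b) = star x * \<Phi> b"
    by (rule *[OF assms(4)])
  have "\<Phi> (star (b * x)) = star x * star (\<Phi> b)"
    using *[of "star b"] assms by (simp add: star_mult mem map_star)
  then have "star (\<Phi> (b * x)) = star (\<Phi> b * x)"
    using assms by (simp add: map_star[symmetric] mem star_mult)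
  then show "\<Phi> (b * x) = \<Phi> b * x"
    by (metis star_star)
qed

lemma fixed_in_bimodule_domain:
  assumes "x \<in> B" and "\<Phi> x = x"
    and "\<Phi> (star x * x) = star x * x" and "\<Phi> (x * star x) = x * star x"
  shows "x \<in> bimodule_domain"
proof -
  have "\<Phi> (star x) = star x"
    using assms by (simp add: map_star)
  then have "\<Phi> (x * b) = x * \<Phi> b" if "b \<in> B" for b
    using fixed_star_mult_left(1)[of "star x" b] assms that by (simp add: mem star_star)
  then show ?thesis
    using fixed_star_mult_left(2)[of x] assms by (auto simp: bimodule_domain_def)
qed

lemma cstar_subalgebra_bimodule_domain: "cstar_subalgebra bimodule_domain"
proof -
  have D: "x \<in> B" "b \<in> B \<Longrightarrow> \<Phi> (x * b) = x * \<Phi> b" "b \<in> B \<Longrightarrow> \<Phi> (b * x) = \<Phi> b * x"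
    if "x \<in> bimodule_domain" for x b
    using that by (auto simp: bimodule_domain_def)
  have "\<Phi> 0 = 0"
    using map_scaleR[of 0 0] by simp
  then have zero_in: "0 \<in> bimodule_domain"
    by (simp add: bimodule_domain_def mem)
  have add_in: "x + y \<in> bimodule_domain" if "x \<in> bimodule_domain" "y \<in> bimodule_domain" for x y
    using that by (auto simp: bimodule_domain_def mem distrib_left distrib_right map_add)
  have scaleC_in: "c *\<^sub>C x \<in> bimodule_domain" if "x \<in> bimodule_domain" for c x
    using that
    by (auto simp: bimodule_domain_def mem mult_scaleC_left mult_scaleC_right map_scaleC)
  have mult_in: "x * y \<in> bimodule_domain" if "x \<in> bimodule_domain" "y \<in> bimodule_domain" for x y
  proof -
    have "\<Phi> (b * (x * y)) = \<Phi> b * (x * y)" "\<Phi> (x * y * b) = x * y * \<Phi> b" if "b \<in> B" for b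
      using D(2)[OF \<open>x \<in> _\<close>, of "y * b"] D(3)[OF \<open>y \<in> _\<close>, of "b * x"]
        D(2)[OF \<open>y \<in> _\<close> that] D(3)[OF \<open>x \<in> _\<close> that] D(1)[OF \<open>x \<in> _\<close>] D(1)[OF \<open>y \<in> _\<close>] that
      by (simp_all add: mem mult.assoc)
    moreover have "x * y \<in> B"
      using that by (intro mem D(1))
    ultimately show ?thesis
      unfolding bimodule_domain_def by blast
  qed
  have star_in: "star x \<in> bimodule_domain" if "x \<in> bimodule_domain" for x
  proof -
    have "\<Phi> (star x * b) = star x * \<Phi> b" "\<Phi> (b * star x) = \<Phi> b * star x" if "b \<in> B" for b
    proof -
      have "\<Phi> (star (star b * x)) = star (\<Phi> (star b) * x)"
        "\<Phi> (star (x * star b)) = star (x * \<Phi> (star b))"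
        using D(1)[OF \<open>x \<in> _\<close>] D(2,3)[OF \<open>x \<in> _\<close>, of "star b"] that
        by (simp_all add: map_star mem)
      then show "\<Phi> (star x * b) = star x * \<Phi> b" "\<Phi> (b * star x) = \<Phi> b * star x"
        using that by (simp_all add: star_mult star_star map_star mem)
    qed
    moreover have "star x \<in> B"
      using that by (intro mem D(1))
    ultimately show ?thesis
      unfolding bimodule_domain_def by blast
  qed
  have closed_domain: "closed bimodule_domain"
  proof (unfold closed_sequential_limits, intro allI impI)
    fix x l
    assume "(\<forall>n. x n \<in> bimodule_domain) \<and> x \<longlonglongrightarrow> l"
    then have x: "\<And>n. x n \<in> bimodule_domain" and lim: "x \<longlonglongrightarrow> l" by auto
    have l: "l \<in> B"
      using closed_sequentially[OF mem(6) _ lim] D(1)[OF x] by blast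
    have "\<Phi> (l * b) = l * \<Phi> b \<and> \<Phi> (b * l) = \<Phi> b * l" if b: "b \<in> B" for b
    proof
      have "(\<lambda>n. \<Phi> (x n * b)) \<longlonglongrightarrow> \<Phi> (l * b)"
        using D(1)[OF x] l b by (intro tendsto_map tendsto_intros lim) (simp_all add: mem)
      moreover have "(\<lambda>n. \<Phi> (x n * b)) \<longlonglongrightarrow> l * \<Phi> b"
        unfolding D(2)[OF x b] by (intro tendsto_intros lim)
      ultimately show "\<Phi> (l * b) = l * \<Phi> b" by (rule LIMSEQ_unique)
      have "(\<lambda>n. \<Phi> (b * x n)) \<longlonglongrightarrow> \<Phi> (b * l)"
        using D(1)[OF x] l b by (intro tendsto_map tendsto_intros lim) (simp_all add: mem)
      moreover have "(\<lambda>n. \<Phi> (b * x n)) \<longlonglongrightarrow> \<Phi> b * l"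
        unfolding D(3)[OF x b] by (intro tendsto_intros lim)
      ultimately show "\<Phi> (b * l) = \<Phi> b * l" by (rule LIMSEQ_unique)
    qed
    with l show "l \<in> bimodule_domain"
      unfolding bimodule_domain_def by blast
  qed
  show ?thesis
    unfolding cstar_subalgebra_def
    by (intro conjI ballI allI zero_in add_in scaleC_in mult_in star_in closed_domain)
qed

end

theorem theorem2p2:
  fixes \<Phi> :: "'a::unital_cstar_algebra \<Rightarrow> 'a" and a :: 'a
  assumes "complex_linear \<Phi>"
    and "\<Phi> 1 = 1"
    and "completely_positive_on (cstar_generated {1, a}) \<Phi>"
  shows
    "({a, star a * a, a * star a} \<subseteq> fixed_points \<Phi>
        \<longleftrightarrow> a \<in> fixed_points \<Phi> \<inter> multiplicative_domain \<Phi>) \<and>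
     (a \<in> fixed_points \<Phi> \<inter> multiplicative_domain \<Phi>
        \<longleftrightarrow> (\<forall>b \<in> cstar_generated {1, a}. \<Phi> (b * a) = \<Phi> b * a \<and> \<Phi> (a * b) = a * \<Phi> b)) \<and>
     ((\<forall>b \<in> cstar_generated {1, a}. \<Phi> (b * a) = \<Phi> b * a \<and> \<Phi> (a * b) = a * \<Phi> b)
        \<longleftrightarrow> cstar_generated {1, a} \<subseteq> fixed_points \<Phi>)"
proof -
  define B where "B = cstar_generated {1, a}"
  have sub: "cstar_subalgebra B" and gen: "1 \<in> B" "a \<in> B"
    using cstar_subalgebra_generated hull_subset[of "{1, a}" cstar_subalgebra]
    by (auto simp: B_def cstar_generated_def)
  interpret unital_cp_self_map B \<Phi>
    using assms sub gen by unfold_locales (simp_all add: B_def)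
  have star_a: "\<Phi> (star a) = star (\<Phi> a)"
    using gen by (simp add: map_star)
  let ?i = "{a, star a * a, a * star a} \<subseteq> fixed_points \<Phi>"
  let ?ii = "a \<in> fixed_points \<Phi> \<inter> multiplicative_domain \<Phi>"
  let ?iii = "\<forall>b\<in>B. \<Phi> (b * a) = \<Phi> b * a \<and> \<Phi> (a * b) = a * \<Phi> b"
  let ?iv = "B \<subseteq> fixed_points \<Phi>"
  have "?i \<longleftrightarrow> ?ii"
    using star_a by (auto simp: fixed_points_def multiplicative_domain_def)
  moreover have "?iv" if ?i
  proof -
    have "a \<in> bimodule_domain"
      using that gen by (intro fixed_in_bimodule_domain) (auto simp: fixed_points_def)
    moreover have "1 \<in> bimodule_domain"
      using one_mem by (simp add: bimodule_domain_def)
    ultimately have "cstar_generated {1, a} \<subseteq> bimodule_domain"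
      unfolding cstar_generated_def
      by (intro hull_minimal cstar_subalgebra_bimodule_domain) auto
    then show ?thesis
      using bimodule_domain_fixed by (auto simp: fixed_points_def simp flip: B_def)
  qed
  moreover have "?iii" if ?iv
    using that gen mem(4) by (auto simp: fixed_points_def subset_iff)
  moreover have "?i" if iii: ?iii
  proof -
    have "\<Phi> a = a"
      using bspec[OF iii gen(1)] unital by simp
    then show ?thesis
      using bspec[OF iii mem(5)[OF gen(2)]] star_a by (simp add: fixed_points_def)
  qed
  ultimately show ?thesis
    unfolding B_def[symmetric] by blast
qed

end
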